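(* Let $q$ be a prime power and let $n\ge r\ge 3$ be integers. Let $\Psi_{q,n}^{(r-1,r)}:\mathcal{H}_n^{(r-1)}(\mathbb{F}_q)\to\mathcal{H}_n^{(r)}(\mathbb{F}_q)$ be defined by $(\Psi_{q,n}^{(r-1,r)}f)(e)=\sum_{e'\subseteq e,\ |e'|=r-1} f(e')$ for every $r$-element subset $e$ of the vertex set. Suppose $f,g\in\mathcal{H}_n^{(r-1)}(\mathbb{F}_q)$ satisfy $\Psi_{q,n}^{(r-1,r)}f=\Psi_{q,n}^{(r-1,r)}g$ and $f\ne g$. Then $f$ and $g$ differ on at least $n-r+2$ hyperedges, i.e. $|\{e'\in E(K_n^{(r-1)}) : f(e')\ne g(e')\}|\ge n-r+2$.
   Context: $\mathbb{F}_q$ denotes the finite field of order $q$. For $2\le k\le n$, $K_n^{(k)}$ is the complete $k$-uniform hypergraph on a fixed $n$-element vertex set $V$: its hyperedges are all $k$-element subsets of $V$. $\mathcal{H}_n^{(k)}(\mathbb{F}_q)$ denotes the set of all maps $f:E(K_n^{(k)})\to\mathbb{F}_q$, a vector space over $\mathbb{F}_q$ under pointwise operations. *)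

theory Defs
  imports "HOL-Library.FuncSet" "HOL-Library.Cardinality" "HOL-Number_Theory.Prime_Powers"
begin

definition complete_hyperedges :: "'v set \<Rightarrow> nat \<Rightarrow> 'v set set" where
  "complete_hyperedges V k = {e. e \<subseteq> V \<and> card e = k}"

text \<open>Maps defined on the hyperedges only are encoded as extensional functions, so that
  HOL equality of two such maps is equality on all hyperedges.\<close>

definition hyperedge_maps :: "'v set \<Rightarrow> nat \<Rightarrow> ('v set \<Rightarrow> 'a) set" where
  "hyperedge_maps V k = complete_hyperedges V k \<rightarrow>\<^sub>E UNIV"

definition Psi :: "'v set \<Rightarrow> nat \<Rightarrow> nat \<Rightarrow> ('v set \<Rightarrow> 'a::comm_monoid_add) \<Rightarrow> 'v set \<Rightarrow> 'a" where
  "Psi V s r f = (\<lambda>e\<in>complete_hyperedges V r. \<Sum>e' | e' \<subseteq> e \<and> card e' = s. f e')"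

lemma Psi_in_hyperedge_maps: "Psi V s r f \<in> hyperedge_maps V r"
  by (simp add: Psi_def hyperedge_maps_def)

end

theory Submission
  imports Defs
begin

text \<open>If \<open>f\<close> and \<open>g\<close> differ at \<open>e\<^sub>0\<close>, then for every vertex \<open>v \<notin> e\<^sub>0\<close> the two equal sums over the
  facets of \<open>e\<^sub>0 \<union> {v}\<close> force a second facet of difference. It is not \<open>e\<^sub>0\<close>, so it contains \<open>v\<close>,
  which is then its only vertex outside \<open>e\<^sub>0\<close>. Hence distinct \<open>v\<close> give distinct hyperedges, and
  together with \<open>e\<^sub>0\<close> there are at least \<open>(n - (r - 1)) + 1\<close> of them.\<close>

text \<open>If \<open>f\<close> and \<open>g\<close> agreed on \<open>S - {x}\<close>, the rest of
  the two sums would coincide, and cancelling it would leave \<open>f x = g x\<close>.\<close>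

lemma sum_eq_imp_second_difference:
  fixes f g :: "'b \<Rightarrow> 'a::cancel_comm_monoid_add"
  assumes "finite S" "x \<in> S" "sum f S = sum g S" "f x \<noteq> g x"
  obtains y where "y \<in> S" "y \<noteq> x" "f y \<noteq> g y"
proof -
  have "sum f (S - {x}) \<noteq> sum g (S - {x})"
    using assms(3,4) sum.remove[OF assms(1,2), of f] sum.remove[OF assms(1,2), of g] by auto
  then obtain y where "y \<in> S - {x}" "f y \<noteq> g y"
    by (meson sum.cong)
  then show thesis using that by blast
qed

text \<open>The form \<open>e' - e = {v}\<close> lets \<open>v\<close> be recovered from
  \<open>e'\<close>, which later makes the choice of \<open>e'\<close> injective in
  \<open>v\<close>.\<close>

lemma Psi_eq_imp_second_difference:
  fixes f g :: "'v set \<Rightarrow> 'a::cancel_comm_monoid_add"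
  assumes "finite V" "Psi V k (Suc k) f = Psi V k (Suc k) g"
    and "e \<in> complete_hyperedges V k" "f e \<noteq> g e" "v \<in> V - e"
  obtains e' where "e' \<in> complete_hyperedges V k" "f e' \<noteq> g e'" "e' - e = {v}"
proof -
  let ?S = "{e'. e' \<subseteq> insert v e \<and> card e' = k}"
  have e: "e \<subseteq> V" "card e = k" "finite e"
    using assms(1,3) by (auto simp: complete_hyperedges_def finite_subset)
  then have "insert v e \<in> complete_hyperedges V (Suc k)"
    using assms(5) by (simp add: complete_hyperedges_def)
  then have sums: "sum f ?S = sum g ?S"
    using fun_cong[OF assms(2), of "insert v e"] by (simp add: Psi_def)
  have S: "finite ?S" "e \<in> ?S"
    using e by auto
  obtain e' where "e' \<in> ?S" and e': "e' \<noteq> e" "f e' \<noteq> g e'"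
    by (rule sum_eq_imp_second_difference[OF S sums assms(4)])
  then have e'_sub: "e' \<subseteq> insert v e" "card e' = k"
    by auto
  have "v \<in> e'"
  proof (rule ccontr)
    assume "v \<notin> e'"
    then have "e' \<subseteq> e"
      using e'_sub(1) by blast
    then show False
      using card_subset_eq[of e e'] e(2,3) e'(1) e'_sub(2) by simp
  qed
  then show thesis
    using that[of e'] e(1) e'(2) e'_sub assms(5) by (auto simp: complete_hyperedges_def)
qed

lemma card_differences_ge:
  fixes f g :: "'v set \<Rightarrow> 'a::cancel_comm_monoid_add"
  assumes "finite V" "Psi V k (Suc k) f = Psi V k (Suc k) g"
    and "e \<in> complete_hyperedges V k" "f e \<noteq> g e"
  shows "card V - k + 1 \<le> card {e' \<in> complete_hyperedges V k. f e' \<noteq> g e'}" (is "_ \<le> card ?D")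
proof -
  have "\<forall>v\<in>V - e. \<exists>e'. e' \<in> ?D \<and> e' - e = {v}"
    using Psi_eq_imp_second_difference[OF assms] by blast
  then obtain c where c: "\<forall>v\<in>V - e. c v \<in> ?D \<and> c v - e = {v}"
    by (rule bchoice[THEN exE])
  have "inj_on c (V - e)"
  proof (rule inj_onI)
    fix v w assume "v \<in> V - e" "w \<in> V - e" "c v = c w"
    then have "{v} = {w}"
      using c by metis
    then show "v = w" by simp
  qed
  \<comment> \<open>Each \<open>c v - e\<close> is a singleton, whereas \<open>e - e\<close> is
    empty.\<close>
  moreover have "e \<notin> c ` (V - e)"
    using c by fastforce
  moreover have "card (V - e) = card V - k"
    using assms(1,3) by (auto simp: complete_hyperedges_def card_Diff_subset finite_subset)
  ultimately have "card (insert e (c ` (V - e))) = card V - k + 1"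
    using assms(1) by (simp add: card_image)
  moreover have "insert e (c ` (V - e)) \<subseteq> ?D"
    using c assms(3,4) by blast
  moreover have "finite ?D"
    using assms(1) by (simp add: complete_hyperedges_def)
  ultimately show ?thesis
    by (metis card_mono)
qed

theorem theorem3:
  fixes V :: "'v set" and q n r :: nat
    and f g :: "'v set \<Rightarrow> 'a::{field, finite}"
  assumes "primepow q" and "CARD('a) = q"
    and "finite V" and "card V = n"
    and "3 \<le> r" and "r \<le> n"
    and "f \<in> hyperedge_maps V (r - 1)" and "g \<in> hyperedge_maps V (r - 1)"
    and "Psi V (r - 1) r f = Psi V (r - 1) r g"
    and "f \<noteq> g"
  shows "card {e' \<in> complete_hyperedges V (r - 1). f e' \<noteq> g e'} \<ge> n - r + 2"
proof -
  \<comment> \<open>Both maps are extensional, so \<open>f \<noteq> g\<close> must show at an actual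
    hyperedge.\<close>
  obtain e where e: "e \<in> complete_hyperedges V (r - 1)" "f e \<noteq> g e"
    using assms(7,8,10) unfolding hyperedge_maps_def by (meson PiE_ext)
  have "Suc (r - 1) = r"
    using assms(5) by simp
  then have "card V - (r - 1) + 1 \<le> card {e' \<in> complete_hyperedges V (r - 1). f e' \<noteq> g e'}"
    using card_differences_ge[of V "r - 1" f g e] assms(3,9) e by simp
  \<comment> \<open>Subtraction on naturals truncates: \<open>n - (r - 1) + 1\<close> equals
    \<open>n - r + 2\<close> because \<open>1 \<le> r\<close> and \<open>r \<le> n\<close>.\<close>
  then show ?thesis
    using assms(4-6) by linarith
qed

end
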